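(* Let $D$ be a set, let $X$ be a real linear space and let $f\colon D\to X$ be an admissible function. Then the following conditions are equivalent: (i) $f(D)$ is a convex set and $$\mathscr{B}_f(x,\lambda)=f^{-1}\bigg(\frac{\sum_{i=1}^n\lambda_if(x_i)}{\sum_{i=1}^n\lambda_i}\bigg)\qquad\text{for all }n\in\mathbb{N}\text{ and }(x,\lambda)\in D^n\times W_n$$ (in particular, the right-hand side is well-defined for all such pairs); (ii) $\sigma_f\equiv0$; (iii) $\mathscr{B}_f$ is associative, that is, $$\mathscr{B}_f\big((x,y),(\lambda,\mu)\big)=\mathscr{B}_f\big(\big(\mathscr{B}_f(x,\lambda),y\big),(\alpha(x,\lambda),\mu)\big)$$ for all pairs $(x,\lambda),(y,\mu)\in\mathscr{W}(D)$; (iv) the equality $\mathscr{B}_f\big((x,y),(\lambda,\mu)\big)=\mathscr{B}_f\big(\big(\mathscr{B}_f(x,\lambda),y\big),(\alpha(x,\lambda),\mu)\big)$ holds for all $(x,\lambda)\in\mathscr{W}(D)$ and $(y,\mu)\in D\times\mathbb{R}_+$.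
   Context: Notation: $\mathbb{R}_+=(0,+\infty)$; $W_n=[0,+\infty)^n\setminus\{(0,\dots,0)\}$; $\mathscr{W}(D)=\bigcup_{n=1}^\infty D^n\times W_n$. For $(x,\lambda)\in D^n\times W_n$ and $(y,\mu)\in D^m\times W_m$, $((x,y),(\lambda,\mu))\in D^{n+m}\times W_{n+m}$ denotes the concatenation. The arithmetic effort function $\alpha\colon\mathscr{W}(D)\to\mathbb{R}_+$ is $\alpha(x,\lambda)=\lambda_1+\dots+\lambda_n$ for $(x,\lambda)\in D^n\times W_n$. Admissible functions and generalized Bajraktarević means: For a nonzero $x$ in a real linear space $X$, the ray generated by $x$ is $R_x=\{\lambda x\mid\lambda\in\mathbb{R}_+\}$; if $y\in R_x$, then $[y:x]$ denotes the unique positive number $\lambda$ with $y=\lambda x$. For $S\subseteq X$, $\operatorname{cone}(S)=\{\lambda x\mid \lambda\in\mathbb{R}_+,\ x\in S\}$. The set $S$ is observable if the rays generated by any two distinct elements of $S$ are disjoint, and conically convex if $\operatorname{cone}(S)$ is convex and $0\notin\operatorname{conv}(S)$. A function $f\colon D\to X$ is admissible if it is injective and $f(D)$ is observable and conically convex. For such $f$, $\pi_f\colon\operatorname{cone}(f(D))\to f(D)$ maps $y$ to the unique point $x\in f(D)$ with $y\in R_x$, and $f^{(-1)}:=f^{-1}\circ\pi_f\colon\operatorname{cone}(f(D))\to D$. For $(x,\lambda)\in D^n\times W_n$ put $\mathscr{B}_f(x,\lambda)=f^{(-1)}\big(\sum_{k=1}^n\lambda_kf(x_k)\big)$ and $\beta_f(x,\lambda)=\big[\sum_{k=1}^n\lambda_kf(x_k):f(\mathscr{B}_f(x,\lambda))\big]$.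 Synergy: $\sigma_f\colon\mathscr{W}(D)\to\mathbb{R}$ is defined by $\sigma_f(x,\lambda)=\beta_f(x,\lambda)-(\lambda_1+\dots+\lambda_n)$ for $(x,\lambda)\in D^n\times W_n$. *)

theory Defs
  imports "HOL-Analysis.Convex"
begin

text \<open>
  A point of \<open>D\<^sup>n \<times> W\<^sub>n\<close> is a pair of lists of the same length \<open>n\<close>; the case \<open>n = 0\<close> is excluded
  because some weight has to be nonzero. Concatenation of such pairs is componentwise \<^term>\<open>(@)\<close>.
\<close>

definition weighted :: "'d set \<Rightarrow> ('d list \<times> real list) set" where
  "weighted D = {(xs, ls). length xs = length ls \<and> set xs \<subseteq> D \<and>
                           (\<forall>l\<in>set ls. 0 \<le> l) \<and> (\<exists>l\<in>set ls. l \<noteq> 0)}"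

definition arith_effort :: "'d list \<Rightarrow> real list \<Rightarrow> real" where
  "arith_effort xs ls = sum_list ls"

definition ray :: "'a::real_vector \<Rightarrow> 'a set" where
  "ray x = {t *\<^sub>R x | t. 0 < t}"

text \<open>Meaningful for \<open>x \<noteq> 0\<close> and \<open>y \<in> ray x\<close>.\<close>

definition ray_ratio :: "'a::real_vector \<Rightarrow> 'a \<Rightarrow> real" where
  "ray_ratio y x = (THE t. 0 < t \<and> y = t *\<^sub>R x)"

text \<open>Unlike the library's \<^term>\<open>cone hull S\<close>, only positive multiples are taken.\<close>

definition pos_cone :: "'a::real_vector set \<Rightarrow> 'a set" where
  "pos_cone S = {t *\<^sub>R x | t x. 0 < t \<and> x \<in> S}"

definition observable :: "'a::real_vector set \<Rightarrow> bool" where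
  "observable S \<longleftrightarrow> (\<forall>x\<in>S. \<forall>y\<in>S. x \<noteq> y \<longrightarrow> ray x \<inter> ray y = {})"

definition conically_convex :: "'a::real_vector set \<Rightarrow> bool" where
  "conically_convex S \<longleftrightarrow> convex (pos_cone S) \<and> 0 \<notin> convex hull S"

definition admissible :: "'d set \<Rightarrow> ('d \<Rightarrow> 'a::real_vector) \<Rightarrow> bool" where
  "admissible D f \<longleftrightarrow> inj_on f D \<and> observable (f ` D) \<and> conically_convex (f ` D)"

text \<open>The next two functions are meaningful on \<^term>\<open>pos_cone (f ` D)\<close>, for admissible \<open>f\<close>.\<close>

definition ray_proj :: "'d set \<Rightarrow> ('d \<Rightarrow> 'a::real_vector) \<Rightarrow> 'a \<Rightarrow> 'a" where
  "ray_proj D f y = (THE x. x \<in> f ` D \<and> y \<in> ray x)"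

definition gen_inv :: "'d set \<Rightarrow> ('d \<Rightarrow> 'a::real_vector) \<Rightarrow> 'a \<Rightarrow> 'd" where
  "gen_inv D f y = inv_into D f (ray_proj D f y)"

definition weighted_sum :: "('d \<Rightarrow> 'a::real_vector) \<Rightarrow> 'd list \<Rightarrow> real list \<Rightarrow> 'a" where
  "weighted_sum f xs ls = (\<Sum>(x, l)\<leftarrow>zip xs ls. l *\<^sub>R f x)"

definition baj_mean :: "'d set \<Rightarrow> ('d \<Rightarrow> 'a::real_vector) \<Rightarrow> 'd list \<Rightarrow> real list \<Rightarrow> 'd" where
  "baj_mean D f xs ls = gen_inv D f (weighted_sum f xs ls)"

definition baj_effort :: "'d set \<Rightarrow> ('d \<Rightarrow> 'a::real_vector) \<Rightarrow> 'd list \<Rightarrow> real list \<Rightarrow> real" where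
  "baj_effort D f xs ls = ray_ratio (weighted_sum f xs ls) (f (baj_mean D f xs ls))"

definition synergy :: "'d set \<Rightarrow> ('d \<Rightarrow> 'a::real_vector) \<Rightarrow> 'd list \<Rightarrow> real list \<Rightarrow> real" where
  "synergy D f xs ls = baj_effort D f xs ls - sum_list ls"

definition mean_associative :: "'d set \<Rightarrow> ('d list \<Rightarrow> real list \<Rightarrow> 'd) \<Rightarrow> bool" where
  "mean_associative D M \<longleftrightarrow>
     (\<forall>(xs, ls)\<in>weighted D. \<forall>(ys, ms)\<in>weighted D.
        M (xs @ ys) (ls @ ms) = M (M xs ls # ys) (arith_effort xs ls # ms))"

end

theory Submission
  imports Defs
begin

text \<open>
  Every weighted sum \<open>w\<close> of points of \<open>f ` D\<close> lies in the convex cone over \<open>f ` D\<close>, so it has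
  polar coordinates: \<open>w = \<beta> *\<^sub>R f z\<close> with exactly one direction \<open>z = \<B>\<^sub>f(x, \<lambda>) \<in> D\<close> and one radius
  \<open>\<beta> = \<beta>\<^sub>f(x, \<lambda>) > 0\<close> (lemmas \<open>weighted_sum_polar\<close> and \<open>polar_unique\<close>). Write \<open>\<alpha>\<close> for the sum of
  the weights. Vanishing synergy says \<open>\<beta> = \<alpha>\<close>, that is, \<open>w / \<alpha> = f z\<close>: normalising by the total
  weight is then the same as projecting along rays onto \<open>f ` D\<close>. This is (i), and it yields (iii),
  because the block \<open>(x, \<lambda>)\<close> may be replaced by its mean with weight \<open>\<alpha>\<close> without changing the
  weighted sum.

  For the way back from (iv), adjoin a point \<open>y\<close> with weight \<open>1\<close>. Condition (iv) puts
  \<open>\<beta> *\<^sub>R f z + f y\<close> and \<open>\<alpha> *\<^sub>R f z + f y\<close> on one ray. If \<open>y \<noteq> z\<close>, admissibility makes \<open>f y\<close> and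
  \<open>f z\<close> linearly independent (lemma \<open>distinct_values_independent\<close>), and comparing coefficients
  gives \<open>\<beta> = \<alpha>\<close>. A suitable \<open>y\<close> is absent only if \<open>D = {z}\<close>, and then \<open>w = \<alpha> *\<^sub>R f z\<close> trivially.
\<close>

section \<open>Geometry of admissible functions\<close>

text \<open>A vanishing combination could be normalised to a convex combination equal to \<open>0\<close>.\<close>

lemma nonneg_combination_eq_0:
  assumes "conically_convex S" "x \<in> S" "y \<in> S" "0 \<le> a" "0 \<le> b" "a *\<^sub>R x + b *\<^sub>R y = 0"
  shows "a = 0 \<and> b = 0"
proof (rule ccontr)
  assume "\<not> (a = 0 \<and> b = 0)"
  hence pos: "a + b > 0" using assms(4,5) by linarith
  have "(a / (a + b)) *\<^sub>R x + (b / (a + b)) *\<^sub>R y \<in> convex hull S"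
  proof (rule convexD[OF convex_convex_hull])
    show "a / (a + b) + b / (a + b) = 1"
      using pos by (simp add: add_divide_distrib[symmetric])
  qed (use assms pos in \<open>auto intro: hull_inc\<close>)
  moreover have "(a / (a + b)) *\<^sub>R x + (b / (a + b)) *\<^sub>R y = (1 / (a + b)) *\<^sub>R (a *\<^sub>R x + b *\<^sub>R y)"
    by (simp add: scaleR_add_right)
  ultimately have "0 \<in> convex hull S"
    using assms(6) by simp
  thus False
    using assms(1) by (simp add: conically_convex_def)
qed

lemma conically_convex_nonzero:
  assumes "conically_convex S" "x \<in> S"
  shows "x \<noteq> 0"
  using assms hull_inc[of x S] by (auto simp: conically_convex_def)

text \<open>
  A linear dependence with coefficients of one sign puts both values on one ray, contradicting
  observability; otherwise some nonnegative combination of them vanishes.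
\<close>

lemma distinct_values_independent:
  assumes adm: "admissible D f" and D: "y \<in> D" "z \<in> D" "y \<noteq> z" and eq: "a *\<^sub>R f z = b *\<^sub>R f y"
  shows "a = 0 \<and> b = 0"
proof -
  have cc: "conically_convex (f ` D)"
    using adm by (simp add: admissible_def)
  have "f y \<noteq> f z"
    using adm D by (auto simp: admissible_def inj_on_def)
  hence disj: "ray (f y) \<inter> ray (f z) = {}"
    using adm D by (simp add: admissible_def observable_def)
  have same_sign: False if "s > 0" "t > 0" "s *\<^sub>R f z = t *\<^sub>R f y" for s t
  proof -
    have "s *\<^sub>R f z \<in> ray (f z)" "t *\<^sub>R f y \<in> ray (f y)"
      using that(1,2) unfolding ray_def by blast+
    thus False using disj that(3) by auto
  qed
  consider "a > 0" "b > 0" | "a < 0" "b < 0" | "a \<ge> 0" "b \<le> 0" | "a \<le> 0" "b \<ge> 0"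
    by linarith
  thus ?thesis
  proof cases
    case 1
    thus ?thesis using same_sign eq by blast
  next
    case 2
    thus ?thesis using same_sign[of "-a" "-b"] eq by simp
  next
    case 3
    thus ?thesis
      using nonneg_combination_eq_0[OF cc, of "f z" "f y" a "-b"] D eq by simp
  next
    case 4
    thus ?thesis
      using nonneg_combination_eq_0[OF cc, of "f z" "f y" "-a" b] D eq by simp
  qed
qed

lemma polar_unique:
  assumes adm: "admissible D f" and D: "y \<in> D" "z \<in> D" and t: "0 < t"
    and eq: "s *\<^sub>R f y = t *\<^sub>R f z"
  shows "y = z \<and> s = t"
proof -
  have "y = z"
    using distinct_values_independent[OF adm D _ eq[symmetric]] t by auto
  moreover have "f z \<noteq> 0"
    using adm D conically_convex_nonzero[of "f ` D"] by (auto simp: admissible_def)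
  ultimately show ?thesis
    using eq by simp
qed

lemma gen_inv_scaleR:
  assumes adm: "admissible D f" and d: "d \<in> D" and t: "0 < t"
  shows "gen_inv D f (t *\<^sub>R f d) = d"
proof -
  have "ray_proj D f (t *\<^sub>R f d) = f d"
    unfolding ray_proj_def
  proof (rule the_equality)
    show "f d \<in> f ` D \<and> t *\<^sub>R f d \<in> ray (f d)"
      using d t by (auto simp: ray_def)
  next
    fix x assume "x \<in> f ` D \<and> t *\<^sub>R f d \<in> ray x"
    then obtain e s where "e \<in> D" "x = f e" "0 < s" "t *\<^sub>R f d = s *\<^sub>R f e"
      by (auto simp: ray_def)
    thus "x = f d"
      using polar_unique[OF adm d, of e s t] by simp
  qed
  thus ?thesis
    using adm d by (simp add: gen_inv_def admissible_def)
qed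

lemma ray_ratio_scaleR:
  assumes "x \<noteq> 0" "0 < t"
  shows "ray_ratio (t *\<^sub>R x) x = t"
  unfolding ray_ratio_def by (rule the_equality) (use assms in auto)

text \<open>Midpoints give sums up to the factor \<open>2\<close>, which a cone absorbs.\<close>

lemma pos_cone_add:
  assumes "convex (pos_cone S)" "x \<in> pos_cone S" "y \<in> pos_cone S"
  shows "x + y \<in> pos_cone S"
proof -
  have "(1/2) *\<^sub>R x + (1/2) *\<^sub>R y \<in> pos_cone S"
    by (rule convexD[OF assms]) auto
  then obtain t s where ts: "0 < t" "s \<in> S" and "(1/2) *\<^sub>R x + (1/2) *\<^sub>R y = t *\<^sub>R s"
    by (auto simp: pos_cone_def)
  hence "2 *\<^sub>R ((1/2) *\<^sub>R x + (1/2) *\<^sub>R y) = (2 * t) *\<^sub>R s"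
    by (metis scaleR_scaleR)
  hence "x + y = (2 * t) *\<^sub>R s"
    by (simp add: scaleR_add_right)
  thus ?thesis
    using ts unfolding pos_cone_def by (intro CollectI exI[of _ "2 * t"] exI[of _ s]) auto
qed

section \<open>Weighted sums and their polar coordinates\<close>

lemma weighted_sum_simps [simp]:
  "weighted_sum f [] [] = 0"
  "weighted_sum f (x # xs) (l # ls) = l *\<^sub>R f x + weighted_sum f xs ls"
  by (simp_all add: weighted_sum_def)

lemma weighted_sum_append:
  assumes "length xs = length ls"
  shows "weighted_sum f (xs @ ys) (ls @ ms) = weighted_sum f xs ls + weighted_sum f ys ms"
  using assms by (simp add: weighted_sum_def)

lemma weighted_sum_const:
  assumes "length xs = length ls" "\<And>x. x \<in> set xs \<Longrightarrow> f x = c"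
  shows "weighted_sum f xs ls = sum_list ls *\<^sub>R c"
  using assms by (induction xs ls rule: list_induct2) (simp_all add: scaleR_add_left)

lemma weighted_append:
  assumes "(xs, ls) \<in> weighted D" "(ys, ms) \<in> weighted D"
  shows "(xs @ ys, ls @ ms) \<in> weighted D"
  using assms by (auto simp: weighted_def)

lemma weighted_Cons_pos:
  assumes "length xs = length ls" "set xs \<subseteq> D" "\<forall>l\<in>set ls. 0 \<le> l" "x \<in> D" "0 < l"
  shows "(x # xs, l # ls) \<in> weighted D"
  using assms by (auto simp: weighted_def)

lemma weighted_sum_list_pos:
  assumes "(xs, ls) \<in> weighted D"
  shows "0 < sum_list ls"
  using assms sum_list_nonneg_eq_0_iff[of ls] sum_list_nonneg[of ls]
  by (fastforce simp: weighted_def)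

text \<open>
  Points of weight \<open>0\<close> are allowed, so the induction has to carry the two cases in which all
  weights so far vanish or the partial sum has already entered the cone.
\<close>

lemma weighted_sum_in_pos_cone:
  assumes conv: "convex (pos_cone (f ` D))" and "(xs, ls) \<in> weighted D"
  shows "weighted_sum f xs ls \<in> pos_cone (f ` D)"
proof -
  have "(\<forall>l\<in>set ls. l = 0) \<and> weighted_sum f xs ls = 0 \<or> weighted_sum f xs ls \<in> pos_cone (f ` D)"
    if "length xs = length ls" "set xs \<subseteq> D" "\<forall>l\<in>set ls. 0 \<le> l"
    using that
  proof (induction xs ls rule: list_induct2)
    case Nil
    thus ?case by simp
  next
    case (Cons x xs l ls)
    hence IH: "(\<forall>l\<in>set ls. l = 0) \<and> weighted_sum f xs ls = 0
        \<or> weighted_sum f xs ls \<in> pos_cone (f ` D)"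
      by simp
    show ?case
    proof (cases "l = 0")
      case True
      thus ?thesis using IH by auto
    next
      case False
      hence "l *\<^sub>R f x \<in> pos_cone (f ` D)"
        using Cons.prems by (force simp: pos_cone_def)
      thus ?thesis
        using IH pos_cone_add[OF conv] by auto
    qed
  qed
  thus ?thesis
    using assms(2) by (auto simp: weighted_def)
qed

lemma baj_polar_eqI:
  assumes adm: "admissible D f" and d: "d \<in> D" and t: "0 < t"
    and eq: "weighted_sum f xs ls = t *\<^sub>R f d"
  shows "baj_mean D f xs ls = d" "baj_effort D f xs ls = t"
proof -
  have "f d \<noteq> 0"
    using adm d conically_convex_nonzero[of "f ` D"] by (auto simp: admissible_def)
  thus "baj_mean D f xs ls = d" "baj_effort D f xs ls = t"
    using gen_inv_scaleR[OF adm d t] ray_ratio_scaleR[of "f d" t] t eq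
    by (simp_all add: baj_mean_def baj_effort_def)
qed

lemma weighted_sum_polar:
  assumes adm: "admissible D f" and w: "(xs, ls) \<in> weighted D"
  shows "baj_mean D f xs ls \<in> D" "0 < baj_effort D f xs ls"
    "weighted_sum f xs ls = baj_effort D f xs ls *\<^sub>R f (baj_mean D f xs ls)"
proof -
  have "weighted_sum f xs ls \<in> pos_cone (f ` D)"
    using weighted_sum_in_pos_cone[where f = f, OF _ w] adm
    by (simp add: admissible_def conically_convex_def)
  then obtain t d where "0 < t" "d \<in> D" "weighted_sum f xs ls = t *\<^sub>R f d"
    by (auto simp: pos_cone_def)
  thus "baj_mean D f xs ls \<in> D" "0 < baj_effort D f xs ls"
    "weighted_sum f xs ls = baj_effort D f xs ls *\<^sub>R f (baj_mean D f xs ls)"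
    using baj_polar_eqI[OF adm] by auto
qed

section \<open>Synergy and associativity\<close>

lemma synergy_eq_0_iff:
  assumes adm: "admissible D f" and w: "(xs, ls) \<in> weighted D"
  shows "synergy D f xs ls = 0 \<longleftrightarrow>
    (1 / sum_list ls) *\<^sub>R weighted_sum f xs ls \<in> f ` D \<and>
    baj_mean D f xs ls = inv_into D f ((1 / sum_list ls) *\<^sub>R weighted_sum f xs ls)"
    (is "_ \<longleftrightarrow> ?normalised \<in> _ \<and> _")
proof
  note polar = weighted_sum_polar[OF adm w]
  assume "synergy D f xs ls = 0"
  hence "?normalised = f (baj_mean D f xs ls)"
    using polar by (simp add: synergy_def)
  thus "?normalised \<in> f ` D \<and> baj_mean D f xs ls = inv_into D f ?normalised"
    using polar(1) adm by (simp add: admissible_def)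
next
  assume "?normalised \<in> f ` D \<and> baj_mean D f xs ls = inv_into D f ?normalised"
  then obtain d where d: "d \<in> D" "?normalised = f d"
    by auto
  have pos: "0 < sum_list ls"
    by (rule weighted_sum_list_pos[OF w])
  have "weighted_sum f xs ls = sum_list ls *\<^sub>R ?normalised"
    using pos by simp
  hence "baj_effort D f xs ls = sum_list ls"
    using baj_polar_eqI(2)[OF adm d(1) pos] d(2) by simp
  thus "synergy D f xs ls = 0"
    by (simp add: synergy_def)
qed

text \<open>Convex combinations of two values are weighted sums of total weight \<open>1\<close>.\<close>

lemma synergy_0_imp_convex_image:
  assumes adm: "admissible D f"
    and syn: "\<And>xs ls. (xs, ls) \<in> weighted D \<Longrightarrow> synergy D f xs ls = 0"
  shows "convex (f ` D)"
proof (rule convexI)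
  fix p q :: 'b and u v :: real
  assume "p \<in> f ` D" "q \<in> f ` D" and uv: "0 \<le> u" "0 \<le> v" "u + v = 1"
  then obtain a b where ab: "a \<in> D" "b \<in> D" "p = f a" "q = f b"
    by auto
  have w: "([a, b], [u, v]) \<in> weighted D"
    using ab uv by (auto simp: weighted_def)
  show "u *\<^sub>R p + v *\<^sub>R q \<in> f ` D"
    using synergy_eq_0_iff[OF adm w] syn[OF w] ab uv by simp
qed

lemma synergy_0_imp_mean_associative:
  assumes adm: "admissible D f"
    and syn: "\<And>xs ls. (xs, ls) \<in> weighted D \<Longrightarrow> synergy D f xs ls = 0"
  shows "mean_associative D (baj_mean D f)"
proof -
  have "baj_mean D f (xs @ ys) (ls @ ms)
      = baj_mean D f (baj_mean D f xs ls # ys) (arith_effort xs ls # ms)"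
    if w: "(xs, ls) \<in> weighted D" for xs ls ys ms
  proof -
    have "length xs = length ls"
      using w by (simp add: weighted_def)
    moreover have "weighted_sum f xs ls = arith_effort xs ls *\<^sub>R f (baj_mean D f xs ls)"
      using weighted_sum_polar(3)[OF adm w] syn[OF w] by (simp add: synergy_def arith_effort_def)
    ultimately have "weighted_sum f (xs @ ys) (ls @ ms)
        = weighted_sum f (baj_mean D f xs ls # ys) (arith_effort xs ls # ms)"
      by (simp add: weighted_sum_append)
    thus ?thesis
      by (simp add: baj_mean_def)
  qed
  thus ?thesis
    by (auto simp: mean_associative_def)
qed

text \<open>
  A single test point \<open>y\<close> off the mean detects the radius of \<open>(x, \<lambda>)\<close>: once \<open>f y\<close> is added, the
  direction of the sum depends on how long a multiple of \<open>f z\<close> the block contributes.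
\<close>

lemma associative_at_point_imp_synergy_0:
  assumes adm: "admissible D f" and w: "(xs, ls) \<in> weighted D"
    and y: "y \<in> D" "y \<noteq> baj_mean D f xs ls"
    and assoc: "baj_mean D f (xs @ [y]) (ls @ [1])
      = baj_mean D f [baj_mean D f xs ls, y] [arith_effort xs ls, 1]"
  shows "synergy D f xs ls = 0"
proof -
  define z where "z = baj_mean D f xs ls"
  define \<beta> where "\<beta> = baj_effort D f xs ls"
  define \<alpha> where "\<alpha> = sum_list ls"
  have z: "z \<in> D" and sum: "weighted_sum f xs ls = \<beta> *\<^sub>R f z"
    using weighted_sum_polar[OF adm w] by (simp_all add: z_def \<beta>_def)
  have \<alpha>: "0 < \<alpha>"
    using weighted_sum_list_pos[OF w] by (simp add: \<alpha>_def)
  have w1: "(xs @ [y], ls @ [1]) \<in> weighted D"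
    using weighted_append[OF w] weighted_Cons_pos[of "[]" "[]" D y 1] y(1) by simp
  have w2: "([z, y], [\<alpha>, 1]) \<in> weighted D"
    using weighted_Cons_pos[of "[y]" "[1]" D z \<alpha>] y(1) z \<alpha> by simp
  define u where "u = baj_mean D f (xs @ [y]) (ls @ [1])"
  have u: "baj_mean D f [z, y] [\<alpha>, 1] = u"
    using assoc by (simp add: u_def z_def \<alpha>_def arith_effort_def)
  obtain s where s: "\<beta> *\<^sub>R f z + f y = s *\<^sub>R f u"
    using weighted_sum_polar(3)[OF adm w1] w sum
    by (auto simp: u_def weighted_def weighted_sum_append)
  obtain t where t: "0 < t" "\<alpha> *\<^sub>R f z + f y = t *\<^sub>R f u"
    using weighted_sum_polar(2,3)[OF adm w2] u by auto
  \<comment> \<open>Eliminate \<open>f u\<close> to obtain a linear relation between the independent vectors \<open>f z\<close>, \<open>f y\<close>.\<close>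
  have "t *\<^sub>R (\<beta> *\<^sub>R f z + f y) = s *\<^sub>R (\<alpha> *\<^sub>R f z + f y)"
    by (simp add: s t(2) mult.commute)
  hence "(t * \<beta> - s * \<alpha>) *\<^sub>R f z = (s - t) *\<^sub>R f y"
    by (simp add: algebra_simps)
  hence "t * \<beta> - s * \<alpha> = 0 \<and> s - t = 0"
    by (rule distinct_values_independent[OF adm y(1) z y(2)[folded z_def]])
  hence "\<beta> = \<alpha>"
    using t(1) by auto
  thus ?thesis
    by (simp add: synergy_def \<alpha>_def \<beta>_def)
qed

lemma associative_imp_synergy_0:
  assumes adm: "admissible D f" and w: "(xs, ls) \<in> weighted D"
    and assoc: "\<And>y. y \<in> D \<Longrightarrow> baj_mean D f (xs @ [y]) (ls @ [1])
      = baj_mean D f [baj_mean D f xs ls, y] [arith_effort xs ls, 1]"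
  shows "synergy D f xs ls = 0"
proof (cases "\<exists>y\<in>D. y \<noteq> baj_mean D f xs ls")
  case True
  thus ?thesis
    using associative_at_point_imp_synergy_0[OF adm w] assoc by blast
next
  case False
  \<comment> \<open>Here \<open>D\<close> consists of the mean alone.\<close>
  hence "weighted_sum f xs ls = sum_list ls *\<^sub>R f (baj_mean D f xs ls)"
    using w by (intro weighted_sum_const) (auto simp: weighted_def)
  hence "baj_effort D f xs ls = sum_list ls"
    by (rule baj_polar_eqI(2)[OF adm weighted_sum_polar(1)[OF adm w] weighted_sum_list_pos[OF w]])
  thus ?thesis
    by (simp add: synergy_def)
qed

theorem theorem7p3:
  fixes D :: "'d set" and f :: "'d \<Rightarrow> 'a::real_vector"
  assumes "admissible D f"
  defines "cond_i \<equiv> convex (f ` D) \<and>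
      (\<forall>(xs, ls)\<in>weighted D.
         (1 / sum_list ls) *\<^sub>R weighted_sum f xs ls \<in> f ` D \<and>
         baj_mean D f xs ls = inv_into D f ((1 / sum_list ls) *\<^sub>R weighted_sum f xs ls))"
    and "cond_ii \<equiv> \<forall>(xs, ls)\<in>weighted D. synergy D f xs ls = 0"
    and "cond_iii \<equiv> mean_associative D (baj_mean D f)"
    and "cond_iv \<equiv> \<forall>(xs, ls)\<in>weighted D. \<forall>y\<in>D. \<forall>m>0.
        baj_mean D f (xs @ [y]) (ls @ [m]) =
        baj_mean D f [baj_mean D f xs ls, y] [arith_effort xs ls, m]"
  shows "(cond_i \<longleftrightarrow> cond_ii) \<and> (cond_ii \<longleftrightarrow> cond_iii) \<and> (cond_iii \<longleftrightarrow> cond_iv)"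
proof -
  note adm = assms(1)
  have i_ii: "cond_i \<longleftrightarrow> cond_ii"
    using synergy_eq_0_iff[OF adm] synergy_0_imp_convex_image[OF adm]
    unfolding cond_i_def cond_ii_def by blast
  have ii_iii: "cond_ii \<Longrightarrow> cond_iii"
    using synergy_0_imp_mean_associative[OF adm] unfolding cond_ii_def cond_iii_def by blast
  have iii_iv: "cond_iii \<Longrightarrow> cond_iv"
  proof -
    assume "cond_iii"
    moreover have "([y], [m]) \<in> weighted D" if "y \<in> D" "0 < m" for y and m :: real
      using that by (simp add: weighted_def)
    ultimately show "cond_iv"
      unfolding cond_iii_def cond_iv_def mean_associative_def by blast
  qed
  have iv_ii: "cond_iv \<Longrightarrow> cond_ii"
  proof -
    assume iv: "cond_iv"
    have "synergy D f xs ls = 0" if w: "(xs, ls) \<in> weighted D" for xs ls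
      by (rule associative_imp_synergy_0[OF adm w])
        (use iv w in \<open>auto simp: cond_iv_def\<close>)
    thus "cond_ii"
      unfolding cond_ii_def by blast
  qed
  show ?thesis
    using i_ii ii_iii iii_iv iv_ii by blast
qed

end
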